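(* Let $n$ be an odd positive integer and consider the dihedral group $D_n=\langle a,b\mid a^2=b^n=1,\ aba=b^{-1}\rangle$ with a multiplicative Lie algebra structure $\star$ given by $a\star b=b^i$, for any fixed $1\le i\le n$. Then $D_n\wedge^L D_n\cong\mathbb{Z}_n\times\mathbb{Z}_n$, and it is a trivial multiplicative Lie algebra.
   Context: Conventions: ${}^xy=xyx^{-1}$, $[x,y]=xyx^{-1}y^{-1}$; $\mathbb{Z}_n$ is the cyclic group of order $n$. A multiplicative Lie algebra is a triple $(K,\cdot,\star)$ where $(K,\cdot)$ is a group and $\star$ is a binary operation on $K$ such that for all $x,y,z\in K$: (1) $x\star x=1$; (2) $x\star(yz)=(x\star y)\cdot{}^y(x\star z)$; (3) $(xy)\star z={}^x(y\star z)\cdot(x\star z)$; (4) $((x\star y)\star{}^yz)((y\star z)\star{}^zx)((z\star x)\star{}^xy)=1$; (5) ${}^z(x\star y)={}^zx\star{}^zy$. One calls $\star$ a multiplicative Lie algebra structure on the group $K$. It is trivial if $x\star y=1$ for all $x,y$. The Lie exterior square $K\wedge^LK$ of $(K,\cdot,\star)$ is the multiplicative Lie algebra (with Lie product $\tilde\star$) generated by formal symbols $a\wedge b$ and $[a,b]_0$ ($a,b\in K$) subject to, for all $a,b,c,u,v\in K$: (1) $1\wedge a=a\wedge1=a\wedge a=[1,a]_0=[a,1]_0=[a,a]_0=1$; (2) $(a\wedge b)(b\wedge a)=1=[a,b]_0[b,a]_0$; (3) $(a\wedge bc)^{-1}(a\wedge b)({}^ba\wedge{}^bc)=1=[a,bc]_0^{-1}[a,b]_0[{}^ba,{}^bc]_0$;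 (4) $(ab\wedge c)^{-1}({}^ab\wedge{}^ac)(a\wedge c)=1=[ab,c]_0^{-1}[{}^ab,{}^ac]_0[a,c]_0$; (5) $[a\wedge b,u\wedge v]=[[a,b]_0,u\wedge v]=[a,b]_0\,\tilde\star\,(u\wedge v)=[a,b]_0\,\tilde\star\,[u,v]_0$; (6) $(a\wedge b)({}^cb\wedge{}^ca)=({}^{ab}a^{-1}\wedge{}^ac)(a\wedge c)$; (7) $[a,b]_0[{}^cb,{}^ca]_0=[{}^{ab}a^{-1},{}^ac]_0[a,c]_0$; (8) $[[a,b]_0,[u,v]_0]=[[a,b],[u,v]]_0$; (9) $(a\wedge b)\,\tilde\star\,(u\wedge v)=(a\star b)\wedge(u\star v)$. *)

theory Defs
  imports "HOL-Algebra.Group" "HOL-Algebra.Elementary_Groups"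
begin

section \<open>Multiplicative Lie algebras\<close>

definition conjugate :: "('a, 'm) monoid_scheme \<Rightarrow> 'a \<Rightarrow> 'a \<Rightarrow> 'a" where
  "conjugate G x y = x \<otimes>\<^bsub>G\<^esub> y \<otimes>\<^bsub>G\<^esub> inv\<^bsub>G\<^esub> x"

definition commutator :: "('a, 'm) monoid_scheme \<Rightarrow> 'a \<Rightarrow> 'a \<Rightarrow> 'a" where
  "commutator G x y = x \<otimes>\<^bsub>G\<^esub> y \<otimes>\<^bsub>G\<^esub> inv\<^bsub>G\<^esub> x \<otimes>\<^bsub>G\<^esub> inv\<^bsub>G\<^esub> y"

locale mult_Lie_algebra = group K for K (structure) +
  fixes star :: "'a \<Rightarrow> 'a \<Rightarrow> 'a"  (infixl \<open>\<star>\<close> 70)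
  assumes star_closed: "\<lbrakk>x \<in> carrier K; y \<in> carrier K\<rbrakk> \<Longrightarrow> x \<star> y \<in> carrier K"
    and star_self: "x \<in> carrier K \<Longrightarrow> x \<star> x = \<one>"
    and star_mult_right: "\<lbrakk>x \<in> carrier K; y \<in> carrier K; z \<in> carrier K\<rbrakk> \<Longrightarrow>
      x \<star> (y \<otimes> z) = (x \<star> y) \<otimes> conjugate K y (x \<star> z)"
    and star_mult_left: "\<lbrakk>x \<in> carrier K; y \<in> carrier K; z \<in> carrier K\<rbrakk> \<Longrightarrow>
      (x \<otimes> y) \<star> z = conjugate K x (y \<star> z) \<otimes> (x \<star> z)"
    and star_Jacobi: "\<lbrakk>x \<in> carrier K; y \<in> carrier K; z \<in> carrier K\<rbrakk> \<Longrightarrow>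
      ((x \<star> y) \<star> conjugate K y z) \<otimes> ((y \<star> z) \<star> conjugate K z x) \<otimes> ((z \<star> x) \<star> conjugate K x y) = \<one>"
    and conjugate_star: "\<lbrakk>x \<in> carrier K; y \<in> carrier K; z \<in> carrier K\<rbrakk> \<Longrightarrow>
      conjugate K z (x \<star> y) = conjugate K z x \<star> conjugate K z y"

definition trivial_mult_Lie_algebra ::
    "('a, 'm) monoid_scheme \<Rightarrow> ('a \<Rightarrow> 'a \<Rightarrow> 'a) \<Rightarrow> bool" where
  "trivial_mult_Lie_algebra K star \<longleftrightarrow>
     mult_Lie_algebra K star \<and> (\<forall>x\<in>carrier K. \<forall>y\<in>carrier K. star x y = \<one>\<^bsub>K\<^esub>)"


section \<open>Groups given by generators and relations\<close>

text \<open>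
  The group presented by the generators in the type \<open>'g\<close> and the relations \<open>R\<close> (pairs of
  group terms) is the algebra of all group terms modulo the least congruence containing
  the group axioms and \<open>R\<close>.
\<close>

datatype 'g gterm = GGen 'g | GOne | GMult "'g gterm" "'g gterm" | GInv "'g gterm"

inductive_set group_cong :: "('g gterm \<times> 'g gterm) set \<Rightarrow> ('g gterm \<times> 'g gterm) set"
  for R where
  rel: "(s, t) \<in> R \<Longrightarrow> (s, t) \<in> group_cong R"
| refl: "(t, t) \<in> group_cong R"
| sym: "(s, t) \<in> group_cong R \<Longrightarrow> (t, s) \<in> group_cong R"
| trans: "(s, t) \<in> group_cong R \<Longrightarrow> (t, u) \<in> group_cong R \<Longrightarrow> (s, u) \<in> group_cong R"
| mult: "(s, s') \<in> group_cong R \<Longrightarrow> (t, t') \<in> group_cong R \<Longrightarrow>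
    (GMult s t, GMult s' t') \<in> group_cong R"
| inv: "(s, s') \<in> group_cong R \<Longrightarrow> (GInv s, GInv s') \<in> group_cong R"
| assoc: "(GMult (GMult s t) u, GMult s (GMult t u)) \<in> group_cong R"
| l_one: "(GMult GOne t, t) \<in> group_cong R"
| l_inv: "(GMult (GInv t) t, GOne) \<in> group_cong R"

definition presented_group :: "('g gterm \<times> 'g gterm) set \<Rightarrow> 'g gterm set monoid" where
  "presented_group R =
     \<lparr>carrier = UNIV // group_cong R,
      mult = (\<lambda>A B. group_cong R `` {GMult s t | s t. s \<in> A \<and> t \<in> B}),
      one = group_cong R `` {GOne}\<rparr>"


section \<open>The dihedral group\<close>

primrec gterm_pow :: "'g gterm \<Rightarrow> nat \<Rightarrow> 'g gterm" where
  "gterm_pow t 0 = GOne"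
| "gterm_pow t (Suc k) = GMult (gterm_pow t k) t"

datatype dihedral_gen = Gen_a | Gen_b

definition dihedral_rels :: "nat \<Rightarrow> (dihedral_gen gterm \<times> dihedral_gen gterm) set" where
  "dihedral_rels n =
     {(gterm_pow (GGen Gen_a) 2, GOne),
      (gterm_pow (GGen Gen_b) n, GOne),
      (GMult (GMult (GGen Gen_a) (GGen Gen_b)) (GGen Gen_a), GInv (GGen Gen_b))}"

definition dihedral_group :: "nat \<Rightarrow> dihedral_gen gterm set monoid" where
  "dihedral_group n = presented_group (dihedral_rels n)"

definition dihedral_a :: "nat \<Rightarrow> dihedral_gen gterm set" where
  "dihedral_a n = group_cong (dihedral_rels n) `` {GGen Gen_a}"

definition dihedral_b :: "nat \<Rightarrow> dihedral_gen gterm set" where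
  "dihedral_b n = group_cong (dihedral_rels n) `` {GGen Gen_b}"


section \<open>Multiplicative Lie algebras given by generators and relations\<close>

datatype 'g lterm =
    LGen 'g
  | LOne
  | LMult "'g lterm" "'g lterm"  (infixl \<open>\<bullet>\<close> 70)
  | LInv "'g lterm"
  | LStar "'g lterm" "'g lterm"  (infixl \<open>\<circledast>\<close> 75)

abbreviation lconj :: "'g lterm \<Rightarrow> 'g lterm \<Rightarrow> 'g lterm" where
  "lconj x y \<equiv> x \<bullet> y \<bullet> LInv x"

abbreviation lcomm :: "'g lterm \<Rightarrow> 'g lterm \<Rightarrow> 'g lterm" where
  "lcomm x y \<equiv> x \<bullet> y \<bullet> LInv x \<bullet> LInv y"

definition lterms :: "'g set \<Rightarrow> 'g lterm set" where
  "lterms X = {t. set_lterm t \<subseteq> X}"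

text \<open>
  Here the generators form a set \<open>X\<close> rather than a whole type, since they will be symbols
  indexed by elements of the carrier of an algebra. The congruence is the least one on
  \<open>lterms X\<close> that contains the axioms of multiplicative Lie algebras and \<open>R\<close>.
\<close>

inductive_set lie_cong ::
    "'g set \<Rightarrow> ('g lterm \<times> 'g lterm) set \<Rightarrow> ('g lterm \<times> 'g lterm) set"
  for X R where
  rel: "\<lbrakk>(s, t) \<in> R; s \<in> lterms X; t \<in> lterms X\<rbrakk> \<Longrightarrow> (s, t) \<in> lie_cong X R"
| refl: "t \<in> lterms X \<Longrightarrow> (t, t) \<in> lie_cong X R"
| sym: "(s, t) \<in> lie_cong X R \<Longrightarrow> (t, s) \<in> lie_cong X R"
| trans: "\<lbrakk>(s, t) \<in> lie_cong X R; (t, u) \<in> lie_cong X R\<rbrakk> \<Longrightarrow> (s, u) \<in> lie_cong X R"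
| mult: "\<lbrakk>(s, s') \<in> lie_cong X R; (t, t') \<in> lie_cong X R\<rbrakk> \<Longrightarrow>
    (s \<bullet> t, s' \<bullet> t') \<in> lie_cong X R"
| inv: "(s, s') \<in> lie_cong X R \<Longrightarrow> (LInv s, LInv s') \<in> lie_cong X R"
| star: "\<lbrakk>(s, s') \<in> lie_cong X R; (t, t') \<in> lie_cong X R\<rbrakk> \<Longrightarrow>
    (s \<circledast> t, s' \<circledast> t') \<in> lie_cong X R"
| assoc: "\<lbrakk>x \<in> lterms X; y \<in> lterms X; z \<in> lterms X\<rbrakk> \<Longrightarrow>
    (x \<bullet> y \<bullet> z, x \<bullet> (y \<bullet> z)) \<in> lie_cong X R"
| l_one: "x \<in> lterms X \<Longrightarrow> (LOne \<bullet> x, x) \<in> lie_cong X R"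
| l_inv: "x \<in> lterms X \<Longrightarrow> (LInv x \<bullet> x, LOne) \<in> lie_cong X R"
| star_self: "x \<in> lterms X \<Longrightarrow> (x \<circledast> x, LOne) \<in> lie_cong X R"
| star_mult_right: "\<lbrakk>x \<in> lterms X; y \<in> lterms X; z \<in> lterms X\<rbrakk> \<Longrightarrow>
    (x \<circledast> (y \<bullet> z), (x \<circledast> y) \<bullet> lconj y (x \<circledast> z)) \<in> lie_cong X R"
| star_mult_left: "\<lbrakk>x \<in> lterms X; y \<in> lterms X; z \<in> lterms X\<rbrakk> \<Longrightarrow>
    ((x \<bullet> y) \<circledast> z, lconj x (y \<circledast> z) \<bullet> (x \<circledast> z)) \<in> lie_cong X R"
| star_Jacobi: "\<lbrakk>x \<in> lterms X; y \<in> lterms X; z \<in> lterms X\<rbrakk> \<Longrightarrow>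
    (((x \<circledast> y) \<circledast> lconj y z) \<bullet> ((y \<circledast> z) \<circledast> lconj z x) \<bullet> ((z \<circledast> x) \<circledast> lconj x y), LOne)
      \<in> lie_cong X R"
| conjugate_star: "\<lbrakk>x \<in> lterms X; y \<in> lterms X; z \<in> lterms X\<rbrakk> \<Longrightarrow>
    (lconj z (x \<circledast> y), lconj z x \<circledast> lconj z y) \<in> lie_cong X R"

definition presented_lie_group ::
    "'g set \<Rightarrow> ('g lterm \<times> 'g lterm) set \<Rightarrow> 'g lterm set monoid" where
  "presented_lie_group X R =
     \<lparr>carrier = lterms X // lie_cong X R,
      mult = (\<lambda>A B. lie_cong X R `` {s \<bullet> t | s t. s \<in> A \<and> t \<in> B}),
      one = lie_cong X R `` {LOne}\<rparr>"

definition presented_lie_star ::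
    "'g set \<Rightarrow> ('g lterm \<times> 'g lterm) set \<Rightarrow> 'g lterm set \<Rightarrow> 'g lterm set \<Rightarrow> 'g lterm set" where
  "presented_lie_star X R = (\<lambda>A B. lie_cong X R `` {s \<circledast> t | s t. s \<in> A \<and> t \<in> B})"


section \<open>The Lie exterior square\<close>

datatype 'a ext_gen = Gen_wedge 'a 'a | Gen_bracket 'a 'a

definition ext_gens :: "('a, 'm) monoid_scheme \<Rightarrow> 'a ext_gen set" where
  "ext_gens K = {Gen_wedge a b | a b. a \<in> carrier K \<and> b \<in> carrier K}
              \<union> {Gen_bracket a b | a b. a \<in> carrier K \<and> b \<in> carrier K}"

abbreviation wedge :: "'a \<Rightarrow> 'a \<Rightarrow> 'a ext_gen lterm"  (infix \<open>\<and>\<^sub>L\<close> 80) where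
  "a \<and>\<^sub>L b \<equiv> LGen (Gen_wedge a b)"

abbreviation bracket :: "'a \<Rightarrow> 'a \<Rightarrow> 'a ext_gen lterm"  (\<open>\<lbrakk>_,/ _\<rbrakk>\<^sub>0\<close>) where
  "\<lbrakk>a, b\<rbrakk>\<^sub>0 \<equiv> LGen (Gen_bracket a b)"

text \<open>
  In \<open>wedge_square\<close> and \<open>bracket_square\<close>, \<open>conjugate K (a \<otimes> b) (inv a)\<close> is the conjugate of
  \<open>inv a\<close> by \<open>a \<otimes> b\<close>. The right-hand sides are the expansions, as in \<open>wedge_mult_left\<close> and
  \<open>bracket_mult_left\<close>, of the symbols for \<open>commutator K a b = a \<otimes> conjugate K b (inv a)\<close> and \<open>c\<close>.
\<close>

inductive_set ext_rels ::
    "('a, 'm) monoid_scheme \<Rightarrow> ('a \<Rightarrow> 'a \<Rightarrow> 'a) \<Rightarrow> ('a ext_gen lterm \<times> 'a ext_gen lterm) set"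
  for K (structure) and star (infixl \<open>\<star>\<close> 70) where
  wedge_one_left: "a \<in> carrier K \<Longrightarrow> (\<one> \<and>\<^sub>L a, LOne) \<in> ext_rels K star"
| wedge_one_right: "a \<in> carrier K \<Longrightarrow> (a \<and>\<^sub>L \<one>, LOne) \<in> ext_rels K star"
| wedge_self: "a \<in> carrier K \<Longrightarrow> (a \<and>\<^sub>L a, LOne) \<in> ext_rels K star"
| bracket_one_left: "a \<in> carrier K \<Longrightarrow> (\<lbrakk>\<one>, a\<rbrakk>\<^sub>0, LOne) \<in> ext_rels K star"
| bracket_one_right: "a \<in> carrier K \<Longrightarrow> (\<lbrakk>a, \<one>\<rbrakk>\<^sub>0, LOne) \<in> ext_rels K star"
| bracket_self: "a \<in> carrier K \<Longrightarrow> (\<lbrakk>a, a\<rbrakk>\<^sub>0, LOne) \<in> ext_rels K star"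
| wedge_antisym: "\<lbrakk>a \<in> carrier K; b \<in> carrier K\<rbrakk> \<Longrightarrow>
    ((a \<and>\<^sub>L b) \<bullet> (b \<and>\<^sub>L a), LOne) \<in> ext_rels K star"
| bracket_antisym: "\<lbrakk>a \<in> carrier K; b \<in> carrier K\<rbrakk> \<Longrightarrow>
    (\<lbrakk>a, b\<rbrakk>\<^sub>0 \<bullet> \<lbrakk>b, a\<rbrakk>\<^sub>0, LOne) \<in> ext_rels K star"
| wedge_mult_right: "\<lbrakk>a \<in> carrier K; b \<in> carrier K; c \<in> carrier K\<rbrakk> \<Longrightarrow>
    (LInv (a \<and>\<^sub>L (b \<otimes> c)) \<bullet> (a \<and>\<^sub>L b) \<bullet> (conjugate K b a \<and>\<^sub>L conjugate K b c), LOne)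
      \<in> ext_rels K star"
| bracket_mult_right: "\<lbrakk>a \<in> carrier K; b \<in> carrier K; c \<in> carrier K\<rbrakk> \<Longrightarrow>
    (LInv \<lbrakk>a, b \<otimes> c\<rbrakk>\<^sub>0 \<bullet> \<lbrakk>a, b\<rbrakk>\<^sub>0 \<bullet> \<lbrakk>conjugate K b a, conjugate K b c\<rbrakk>\<^sub>0, LOne)
      \<in> ext_rels K star"
| wedge_mult_left: "\<lbrakk>a \<in> carrier K; b \<in> carrier K; c \<in> carrier K\<rbrakk> \<Longrightarrow>
    (LInv ((a \<otimes> b) \<and>\<^sub>L c) \<bullet> (conjugate K a b \<and>\<^sub>L conjugate K a c) \<bullet> (a \<and>\<^sub>L c), LOne)
      \<in> ext_rels K star"
| bracket_mult_left: "\<lbrakk>a \<in> carrier K; b \<in> carrier K; c \<in> carrier K\<rbrakk> \<Longrightarrow>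
    (LInv \<lbrakk>a \<otimes> b, c\<rbrakk>\<^sub>0 \<bullet> \<lbrakk>conjugate K a b, conjugate K a c\<rbrakk>\<^sub>0 \<bullet> \<lbrakk>a, c\<rbrakk>\<^sub>0, LOne)
      \<in> ext_rels K star"
| comm_wedge_wedge: "\<lbrakk>a \<in> carrier K; b \<in> carrier K; u \<in> carrier K; v \<in> carrier K\<rbrakk> \<Longrightarrow>
    (lcomm (a \<and>\<^sub>L b) (u \<and>\<^sub>L v), lcomm \<lbrakk>a, b\<rbrakk>\<^sub>0 (u \<and>\<^sub>L v)) \<in> ext_rels K star"
| comm_bracket_wedge: "\<lbrakk>a \<in> carrier K; b \<in> carrier K; u \<in> carrier K; v \<in> carrier K\<rbrakk> \<Longrightarrow>
    (lcomm \<lbrakk>a, b\<rbrakk>\<^sub>0 (u \<and>\<^sub>L v), \<lbrakk>a, b\<rbrakk>\<^sub>0 \<circledast> (u \<and>\<^sub>L v)) \<in> ext_rels K star"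
| star_bracket_wedge: "\<lbrakk>a \<in> carrier K; b \<in> carrier K; u \<in> carrier K; v \<in> carrier K\<rbrakk> \<Longrightarrow>
    (\<lbrakk>a, b\<rbrakk>\<^sub>0 \<circledast> (u \<and>\<^sub>L v), \<lbrakk>a, b\<rbrakk>\<^sub>0 \<circledast> \<lbrakk>u, v\<rbrakk>\<^sub>0) \<in> ext_rels K star"
| wedge_square: "\<lbrakk>a \<in> carrier K; b \<in> carrier K; c \<in> carrier K\<rbrakk> \<Longrightarrow>
    ((a \<and>\<^sub>L b) \<bullet> (conjugate K c b \<and>\<^sub>L conjugate K c a),
     (conjugate K (a \<otimes> b) (inv a) \<and>\<^sub>L conjugate K a c) \<bullet> (a \<and>\<^sub>L c)) \<in> ext_rels K star"
| bracket_square: "\<lbrakk>a \<in> carrier K; b \<in> carrier K; c \<in> carrier K\<rbrakk> \<Longrightarrow>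
    (\<lbrakk>a, b\<rbrakk>\<^sub>0 \<bullet> \<lbrakk>conjugate K c b, conjugate K c a\<rbrakk>\<^sub>0,
     \<lbrakk>conjugate K (a \<otimes> b) (inv a), conjugate K a c\<rbrakk>\<^sub>0 \<bullet> \<lbrakk>a, c\<rbrakk>\<^sub>0) \<in> ext_rels K star"
| comm_bracket_bracket: "\<lbrakk>a \<in> carrier K; b \<in> carrier K; u \<in> carrier K; v \<in> carrier K\<rbrakk> \<Longrightarrow>
    (lcomm \<lbrakk>a, b\<rbrakk>\<^sub>0 \<lbrakk>u, v\<rbrakk>\<^sub>0, \<lbrakk>commutator K a b, commutator K u v\<rbrakk>\<^sub>0) \<in> ext_rels K star"
| star_wedge_wedge: "\<lbrakk>a \<in> carrier K; b \<in> carrier K; u \<in> carrier K; v \<in> carrier K\<rbrakk> \<Longrightarrow>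
    ((a \<and>\<^sub>L b) \<circledast> (u \<and>\<^sub>L v), (a \<star> b) \<and>\<^sub>L (u \<star> v)) \<in> ext_rels K star"

text \<open>
  The multiplicative Lie algebra \<open>K \<and>\<^sup>L K\<close> is split into its underlying group and its
  Lie product.
\<close>

definition ext_square_group ::
    "('a, 'm) monoid_scheme \<Rightarrow> ('a \<Rightarrow> 'a \<Rightarrow> 'a) \<Rightarrow> 'a ext_gen lterm set monoid" where
  "ext_square_group K star = presented_lie_group (ext_gens K) (ext_rels K star)"

definition ext_square_star ::
    "('a, 'm) monoid_scheme \<Rightarrow> ('a \<Rightarrow> 'a \<Rightarrow> 'a)
       \<Rightarrow> 'a ext_gen lterm set \<Rightarrow> 'a ext_gen lterm set \<Rightarrow> 'a ext_gen lterm set" where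
  "ext_square_star K star = presented_lie_star (ext_gens K) (ext_rels K star)"

end

theory Submission
  imports Defs "HOL-Algebra.Multiplicative_Group"
begin

text \<open>
  Call a map \<open>f\<close> from pairs of elements of a group \<open>K\<close> to a group \<open>G\<close> an exterior pairing if
  \<open>f x x = 1\<close> and \<open>f\<close> expands products in either argument in the way commutators do. Four such maps
  occur here: the commutator of \<open>K\<close>, a Lie product \<open>\<star>\<close> on \<open>K\<close>, and the two families of
  generators \<open>x \<and> y\<close> and \<open>[x, y]\<^sub>0\<close> of \<open>K \<and>\<^sup>L K\<close>. For the dihedral group, an exterior
  pairing is determined by \<open>f a b\<close>: every value is a power of \<open>f a b\<close>, and \<open>f a b\<close> to the power
  \<open>n\<close> is \<open>1\<close> (\<open>value_is_power\<close>, \<open>value_pow_n\<close>).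

  Upper bound. Put \<open>w = a \<and> b\<close> and \<open>c = [a, b]\<^sub>0\<close>. By the above, \<open>w\<close> and \<open>c\<close> have order
  dividing \<open>n\<close> and generate \<open>K \<and>\<^sup>L K\<close> as a multiplicative Lie algebra. The defining relations give
  \<open>[w, w] = [c, w] = c \<star> w\<close>, and \<open>[w, w] = 1\<close>. So \<open>w\<close> and \<open>c\<close> commute, and the
  Lie product of any two of them is \<open>1\<close>. A Lie product that vanishes on a set vanishes on the
  subgroup that the set generates (\<open>star_trivial_on_generate\<close>). Hence that subgroup is closed under
  the Lie product, it is all of \<open>K \<and>\<^sup>L K\<close>, the Lie product is trivial, and
  \<open>(j, k) \<mapsto> w\<^sup>j c\<^sup>k\<close> is a surjective homomorphism from \<open>\<int>\<^sub>n \<times> \<int>\<^sub>n\<close>.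

  Lower bound. Commutators commute with each other, since they are powers of \<open>[a, b]\<close>; so do values of
  \<open>\<star>\<close>, since they are powers of \<open>a \<star> b\<close>. It follows that
  \<open>x \<and> y \<mapsto> ([x, y], 1)\<close> and \<open>[x, y]\<^sub>0 \<mapsto> (1, [x, y])\<close> respect the defining
  relations when \<open>K \<times> K\<close> carries the trivial Lie product (\<open>ext_square_hom_commutators\<close>). The
  resulting homomorphism sends \<open>w\<^sup>j c\<^sup>k\<close> to the pair of the \<open>j\<close>-th and the \<open>k\<close>-th powers
  of \<open>[a, b]\<close>, the inverse square of \<open>b\<close>, which has order \<open>n\<close> because \<open>n\<close> is odd. So the
  surjection above is injective.
\<close>


section \<open>Powers, conjugation and commutators\<close>

context group
begin

lemma inv_mult_cancel_left: "\<lbrakk>x \<in> carrier G; y \<in> carrier G\<rbrakk> \<Longrightarrow> inv x \<otimes> (x \<otimes> y) = y"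
  by (simp flip: m_assoc)

lemma mult_inv_cancel_left: "\<lbrakk>x \<in> carrier G; y \<in> carrier G\<rbrakk> \<Longrightarrow> x \<otimes> (inv x \<otimes> y) = y"
  by (simp flip: m_assoc)

text \<open>
  Together with the inverse and unit laws, these rewrite a product of elements and inverses to its
  right-associated reduced form, and so decide identities that hold in all groups.
\<close>

lemmas word_simps = m_assoc inv_mult_group inv_mult_cancel_left mult_inv_cancel_left

lemma conjugate_int_pow:
  assumes "x \<in> carrier G" and "y \<in> carrier G"
  shows "conjugate G x (y [^] (k :: int)) = conjugate G x y [^] k"
proof -
  have "conjugate G x \<in> hom G G"
    using assms by (intro homI) (simp_all add: conjugate_def word_simps)
  then show ?thesis
    using assms by (intro hom_int_pow) (simp_all add: is_group)
qed

lemma conjugate_eq_iff_commute: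
  assumes "x \<in> carrier G" and "y \<in> carrier G"
  shows "conjugate G x y = y \<longleftrightarrow> x \<otimes> y = y \<otimes> x"
  using assms by (simp add: conjugate_def inv_solve_right')

lemma int_pow_commute:
  assumes "x \<otimes> y = y \<otimes> x" and "x \<in> carrier G" and "y \<in> carrier G"
  shows "x [^] (j :: int) \<otimes> y [^] (k :: int) = y [^] k \<otimes> x [^] j"
proof -
  have pow: "u \<otimes> v [^] i = v [^] i \<otimes> u"
    if "u \<otimes> v = v \<otimes> u" "u \<in> carrier G" "v \<in> carrier G" for u v and i :: int
    using that by (simp add: conjugate_int_pow flip: conjugate_eq_iff_commute)
  show ?thesis
    using pow[OF pow[OF assms, of k, symmetric]] assms by simp
qed

lemma commutator_eq_one_iff_commute:
  assumes "x \<in> carrier G" and "y \<in> carrier G"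
  shows "commutator G x y = \<one> \<longleftrightarrow> x \<otimes> y = y \<otimes> x"
  using assms by (simp add: commutator_def inv_solve_right')

lemma int_pow_mod:
  assumes "x [^] n = \<one>" and "x \<in> carrier G"
  shows "x [^] (j mod int n) = x [^] j"
proof -
  have "int (ord x) dvd int n"
    using assms pow_eq_id by auto
  then have "int (ord x) dvd j - j mod int n"
    by (meson dvd_minus_mod dvd_trans)
  then show ?thesis
    using assms by (metis int_pow_eq dvd_diff_commute)
qed

end

section \<open>Groups given by a presentation\<close>

lemma equiv_group_cong: "equiv UNIV (group_cong R)"
  by (rule equivI)
    (auto simp: refl_on_def sym_def trans_def intro: group_cong.refl group_cong.sym group_cong.trans)

lemma group_cong_class_eq_iff:
  "group_cong R `` {s} = group_cong R `` {t} \<longleftrightarrow> (s, t) \<in> group_cong R"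
  using equiv_class_eq_iff[OF equiv_group_cong] by blast

lemma presented_group_class_in_carrier: "group_cong R `` {t} \<in> carrier (presented_group R)"
  by (simp add: presented_group_def quotientI)

lemma presented_group_carrierE:
  assumes "x \<in> carrier (presented_group R)"
  obtains t where "x = group_cong R `` {t}"
  using assms by (auto simp: presented_group_def elim: quotientE)

lemma presented_group_one: "\<one>\<^bsub>presented_group R\<^esub> = group_cong R `` {GOne}"
  by (simp add: presented_group_def)

lemma presented_group_mult:
  "group_cong R `` {s} \<otimes>\<^bsub>presented_group R\<^esub> group_cong R `` {t} = group_cong R `` {GMult s t}"
proof -
  have "(GMult s t, u) \<in> group_cong R"
    if "(s, s') \<in> group_cong R" "(t, t') \<in> group_cong R" "(GMult s' t', u) \<in> group_cong R" for s' t' u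
    using that group_cong.mult group_cong.trans by blast
  then show ?thesis
    by (auto simp: presented_group_def intro: group_cong.refl)
qed

lemma group_presented_group: "group (presented_group R)"
proof (rule groupI)
  fix x y z
  assume "x \<in> carrier (presented_group R)" "y \<in> carrier (presented_group R)"
    "z \<in> carrier (presented_group R)"
  then show "x \<otimes>\<^bsub>presented_group R\<^esub> y \<otimes>\<^bsub>presented_group R\<^esub> z =
      x \<otimes>\<^bsub>presented_group R\<^esub> (y \<otimes>\<^bsub>presented_group R\<^esub> z)"
    by (elim presented_group_carrierE)
      (simp add: presented_group_mult group_cong_class_eq_iff group_cong.assoc)
next
  fix x assume "x \<in> carrier (presented_group R)"
  then obtain t where t: "x = group_cong R `` {t}" by (elim presented_group_carrierE)
  show "\<exists>y\<in>carrier (presented_group R). y \<otimes>\<^bsub>presented_group R\<^esub> x = \<one>\<^bsub>presented_group R\<^esub>"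
    by (rule bexI[of _ "group_cong R `` {GInv t}"])
      (simp_all add: t presented_group_mult presented_group_one group_cong_class_eq_iff
        group_cong.l_inv presented_group_class_in_carrier)
next
  fix x assume "x \<in> carrier (presented_group R)"
  then show "\<one>\<^bsub>presented_group R\<^esub> \<otimes>\<^bsub>presented_group R\<^esub> x = x"
    by (elim presented_group_carrierE)
      (simp add: presented_group_mult presented_group_one group_cong_class_eq_iff group_cong.l_one)
qed (auto elim!: presented_group_carrierE
    simp: presented_group_mult presented_group_one presented_group_class_in_carrier)

lemma presented_group_inv:
  "inv\<^bsub>presented_group R\<^esub> (group_cong R `` {t}) = group_cong R `` {GInv t}"
  by (rule group.inv_equality[OF group_presented_group])
    (simp_all add: presented_group_mult presented_group_one group_cong_class_eq_iff
      group_cong.l_inv presented_group_class_in_carrier)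

lemma presented_group_pow:
  "group_cong R `` {t} [^]\<^bsub>presented_group R\<^esub> k = group_cong R `` {gterm_pow t k}"
  by (induction k)
    (simp_all add: presented_group_mult presented_group_one nat_pow_def)

lemma presented_group_generated:
  "carrier (presented_group R) =
     generate (presented_group R) (range (\<lambda>g. group_cong R `` {GGen g}))"
    (is "_ = generate ?G ?S")
proof
  have "group_cong R `` {t} \<in> generate ?G ?S" for t
  proof (induction t)
    case (GMult s t)
    then show ?case using generate.eng by (metis presented_group_mult)
  next
    case (GInv t)
    then show ?case
      using group.generate_m_inv_closed[OF group_presented_group] presented_group_class_in_carrier
      by (metis image_subsetI presented_group_inv)
  qed (auto intro: generate.incl simp flip: presented_group_one simp: generate.one)
  then show "carrier ?G \<subseteq> generate ?G ?S"
    by (auto elim: presented_group_carrierE)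
  show "generate ?G ?S \<subseteq> carrier ?G"
    by (rule group.generate_incl[OF group_presented_group])
      (auto simp: presented_group_class_in_carrier)
qed


section \<open>The dihedral group\<close>

text \<open>
  The locale covers all quotients of the group presented by these relations: the order of \<open>b\<close> may be
  a proper divisor of \<open>n\<close>. Powers of \<open>b\<close> are called rotations, the elements \<open>b\<^sup>k a\<close> reflections.
\<close>

locale dihedral = group K for K (structure) +
  fixes a b :: 'a and n :: nat
  assumes a_closed [simp]: "a \<in> carrier K"
    and b_closed [simp]: "b \<in> carrier K"
    and a_square: "a \<otimes> a = \<one>"
    and b_pow_n: "b [^] n = \<one>"
    and aba: "a \<otimes> b \<otimes> a = inv b"
    and generated: "carrier K = generate K {a, b}"
begin

lemma inv_a: "inv a = a"
  by (rule inv_equality) (simp_all add: a_square)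

lemma a_b_pow: "a \<otimes> b [^] (k :: int) = b [^] (- k) \<otimes> a"
proof -
  have "conjugate K a (b [^] k) = conjugate K a b [^] k"
    by (simp add: conjugate_int_pow)
  also have "conjugate K a b = inv b"
    by (simp add: conjugate_def inv_a aba)
  also have "inv b [^] k = b [^] (- k)"
    by (simp add: int_pow_inv int_pow_neg)
  finally have "a \<otimes> b [^] k \<otimes> a = b [^] (- k)"
    by (simp add: conjugate_def inv_a)
  then have "a \<otimes> b [^] k \<otimes> a \<otimes> a = b [^] (- k) \<otimes> a"
    by simp
  then show ?thesis
    by (simp add: m_assoc a_square)
qed

lemma reflection_mult_rotation:
  "b [^] j \<otimes> a \<otimes> b [^] k = b [^] (j - k :: int) \<otimes> a"
proof -
  have "b [^] j \<otimes> a \<otimes> b [^] k = b [^] j \<otimes> (b [^] (- k) \<otimes> a)"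
    by (simp add: m_assoc a_b_pow)
  then show ?thesis
    by (simp add: int_pow_diff int_pow_neg flip: m_assoc)
qed

lemma reflection_mult_reflection:
  "b [^] j \<otimes> a \<otimes> (b [^] k \<otimes> a) = b [^] (j - k :: int)"
proof -
  have "b [^] j \<otimes> a \<otimes> (b [^] k \<otimes> a) = b [^] (j - k) \<otimes> a \<otimes> a"
    by (simp add: reflection_mult_rotation flip: m_assoc)
  then show ?thesis
    by (simp add: m_assoc a_square)
qed

lemma rotation_mult_reflection: "b [^] j \<otimes> (b [^] k \<otimes> a) = b [^] (j + k :: int) \<otimes> a"
  by (simp add: int_pow_mult m_assoc)

lemma inv_reflection: "inv (b [^] (j :: int) \<otimes> a) = b [^] j \<otimes> a"
  by (rule inv_equality) (simp_all add: reflection_mult_reflection)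

lemmas dihedral_simps = int_pow_mult[symmetric] int_pow_neg[symmetric] reflection_mult_rotation
  reflection_mult_reflection rotation_mult_reflection inv_reflection

lemma rotation_or_reflection:
  assumes "x \<in> carrier K"
  shows "\<exists>k :: int. x = b [^] k \<or> x = b [^] k \<otimes> a"
proof -
  have "x \<in> generate K {a, b}"
    using assms generated by simp
  then show ?thesis
  proof (induction rule: generate.induct)
    case one
    then show ?case by (metis int_pow_0)
  next
    case (incl h)
    then show ?case by (metis a_closed b_closed insertE int_pow_0 int_pow_1 l_one singletonD)
  next
    case (inv h)
    then show ?case
      by (metis a_closed b_closed insertE int_pow_0 int_pow_1 int_pow_neg inv_a l_one singletonD)
  next
    case (eng x y)
    then show ?case
      by (elim exE disjE) (auto simp: dihedral_simps)
  qed
qed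

lemma carrier_cases:
  assumes "x \<in> carrier K"
  obtains (rotation) k :: int where "x = b [^] k"
    | (reflection) k :: int where "x = b [^] k \<otimes> a"
  using rotation_or_reflection[OF assms] by blast

lemma conjugate_rotation_rotation: "conjugate K (b [^] j) (b [^] k) = b [^] (k :: int)" for j :: int
  by (simp add: conjugate_def dihedral_simps)

lemma conjugate_rotation_reflection:
  "conjugate K (b [^] j) (b [^] k \<otimes> a) = b [^] (k + 2 * j :: int) \<otimes> a"
  by (simp add: conjugate_def dihedral_simps algebra_simps)

lemma commutator_a_b: "commutator K a b = b [^] (- 2 :: int)"
proof -
  have "commutator K a b = inv b \<otimes> inv b"
    by (simp add: commutator_def inv_a aba)
  also have "inv b = b [^] (- 1 :: int)"
    by (simp add: int_pow_neg)
  finally show ?thesis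
    by (simp flip: int_pow_mult)
qed

end

lemma dihedral_dihedral_group: "dihedral (dihedral_group n) (dihedral_a n) (dihedral_b n) n"
proof -
  have UNIV: "UNIV = {Gen_a, Gen_b}"
    using dihedral_gen.exhaust by blast
  show ?thesis
    unfolding dihedral_group_def dihedral_a_def dihedral_b_def
  proof (intro dihedral.intro dihedral_axioms.intro)
    let ?R = "dihedral_rels n" and ?a = "GGen Gen_a"
    have "(GMult (GMult GOne ?a) ?a, GOne) \<in> group_cong ?R"
      by (rule group_cong.rel) (simp add: dihedral_rels_def numeral_2_eq_2)
    moreover have "(GMult ?a ?a, GMult (GMult GOne ?a) ?a) \<in> group_cong ?R"
      by (intro group_cong.mult group_cong.refl group_cong.sym[OF group_cong.l_one])
    ultimately show "group_cong ?R `` {?a} \<otimes>\<^bsub>presented_group ?R\<^esub> group_cong ?R `` {?a}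
       = \<one>\<^bsub>presented_group ?R\<^esub>"
      unfolding presented_group_mult presented_group_one group_cong_class_eq_iff
      by (rule group_cong.trans[rotated])
    show "group_cong ?R `` {GGen Gen_b} [^]\<^bsub>presented_group ?R\<^esub> n = \<one>\<^bsub>presented_group ?R\<^esub>"
      unfolding presented_group_pow presented_group_one group_cong_class_eq_iff
      by (rule group_cong.rel) (simp add: dihedral_rels_def)
    show "group_cong ?R `` {?a} \<otimes>\<^bsub>presented_group ?R\<^esub> group_cong ?R `` {GGen Gen_b}
        \<otimes>\<^bsub>presented_group ?R\<^esub> group_cong ?R `` {?a} = inv\<^bsub>presented_group ?R\<^esub> (group_cong ?R `` {GGen Gen_b})"
      unfolding presented_group_mult presented_group_inv group_cong_class_eq_iff
      by (rule group_cong.rel) (simp add: dihedral_rels_def)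
    show "carrier (presented_group ?R) =
        generate (presented_group ?R) {group_cong ?R `` {?a}, group_cong ?R `` {GGen Gen_b}}"
      using presented_group_generated[of ?R] by (simp add: UNIV)
  qed (simp_all add: presented_group_class_in_carrier group_presented_group)
qed

text \<open>
  To see that no smaller power of \<open>b\<close> vanishes, terms are evaluated as isometries of the integers:
  \<open>(e, k)\<close> with \<open>e = \<plusminus> 1\<close> stands for \<open>z \<mapsto> k + e z\<close>, so that \<open>a\<close> is the reflection at \<open>0\<close> and
  \<open>b\<close> the translation by \<open>1\<close>. This is the infinite dihedral group; the relation \<open>b\<^sup>n = 1\<close> holds in
  it modulo \<open>n\<close>.
\<close>

primrec dihedral_eval :: "dihedral_gen gterm \<Rightarrow> int \<times> int" where
  "dihedral_eval (GGen g) = (case g of Gen_a \<Rightarrow> (- 1, 0) | Gen_b \<Rightarrow> (1, 1))"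
| "dihedral_eval GOne = (1, 0)"
| "dihedral_eval (GMult s t) =
     (fst (dihedral_eval s) * fst (dihedral_eval t),
      snd (dihedral_eval s) + fst (dihedral_eval s) * snd (dihedral_eval t))"
| "dihedral_eval (GInv s) =
     (fst (dihedral_eval s), - (fst (dihedral_eval s) * snd (dihedral_eval s)))"

lemma dihedral_eval_sign: "fst (dihedral_eval t) = 1 \<or> fst (dihedral_eval t) = - 1"
  by (induction t) (auto split: dihedral_gen.splits)

lemma dihedral_eval_pow_b: "dihedral_eval (gterm_pow (GGen Gen_b) k) = (1, int k)"
  by (induction k) auto

lemma dihedral_eval_cong:
  assumes "(s, t) \<in> group_cong (dihedral_rels n)"
  shows "fst (dihedral_eval s) = fst (dihedral_eval t)
       \<and> int n dvd snd (dihedral_eval s) - snd (dihedral_eval t)"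
  using assms
proof induction
  case (rel s t)
  then show ?case
    by (auto simp: dihedral_rels_def dihedral_eval_pow_b numeral_2_eq_2)
next
  case (sym s t)
  then show ?case by (auto simp: dvd_diff_commute)
next
  case (trans s t u)
  then have "int n dvd (snd (dihedral_eval s) - snd (dihedral_eval t))
      + (snd (dihedral_eval t) - snd (dihedral_eval u))"
    by (intro dvd_add) auto
  with trans show ?case by simp
next
  case (mult s s' t t')
  then have "int n dvd (snd (dihedral_eval s) - snd (dihedral_eval s'))
      + fst (dihedral_eval s) * (snd (dihedral_eval t) - snd (dihedral_eval t'))"
    by (intro dvd_add dvd_mult) auto
  with mult show ?case by (simp add: algebra_simps)
next
  case (inv s s')
  then have "int n dvd fst (dihedral_eval s) * (snd (dihedral_eval s') - snd (dihedral_eval s))"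
    by (intro dvd_mult) (simp add: dvd_diff_commute)
  with inv show ?case by (simp add: algebra_simps)
next
  case (l_inv t)
  then show ?case using dihedral_eval_sign[of t] by auto
qed (auto simp: algebra_simps)

lemma dihedral_b_int_pow_eq_one_iff:
  "dihedral_b n [^]\<^bsub>dihedral_group n\<^esub> (j :: int) = \<one>\<^bsub>dihedral_group n\<^esub> \<longleftrightarrow> int n dvd j"
proof -
  interpret dihedral "dihedral_group n" "dihedral_a n" "dihedral_b n" n
    by (rule dihedral_dihedral_group)
  have nat: "n dvd k" if "dihedral_b n [^]\<^bsub>dihedral_group n\<^esub> k = \<one>\<^bsub>dihedral_group n\<^esub>" for k :: nat
  proof -
    have "(gterm_pow (GGen Gen_b) k, GOne) \<in> group_cong (dihedral_rels n)"
      using that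
      by (simp add: dihedral_b_def dihedral_group_def presented_group_pow presented_group_one
          group_cong_class_eq_iff)
    from dihedral_eval_cong[OF this] show ?thesis
      by (simp add: dihedral_eval_pow_b)
  qed
  have "ord (dihedral_b n) = n"
    using nat b_pow_n by (metis b_closed dvd_antisym pow_eq_id pow_ord_eq_1)
  then show ?thesis
    by (simp add: int_pow_eq_id)
qed


section \<open>Exterior pairings\<close>

lemma int_add_hom_eq_int_pow:
  fixes G (structure)
  assumes "group G" and closed: "\<And>j :: int. h j \<in> carrier G"
    and add: "\<And>j k. h (j + k) = h j \<otimes>\<^bsub>G\<^esub> h k"
  shows "h j = h 1 [^]\<^bsub>G\<^esub> j"
proof -
  interpret group G by fact
  have zero: "h 0 = \<one>"
    using add[of 0 0] closed by simp
  show ?thesis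
  proof (induction j rule: int_induct[where k = 0])
    case (step1 i)
    then show ?case by (simp add: add int_pow_mult closed)
  next
    case (step2 i)
    have "h (i - 1) \<otimes> h 1 = h 1 [^] (i - 1) \<otimes> h 1 [^] (1 :: int)"
      unfolding add[symmetric] int_pow_mult[OF closed, symmetric] using step2 by simp
    then show ?case
      by (simp add: closed)
  qed (simp add: zero)
qed

text \<open>
  These are the maps that factor through the nonabelian exterior square of \<open>K\<close>. The values need not
  commute.
\<close>

locale exterior_pairing = K: group K + G: group G for K (structure) and G (structure) +
  fixes f :: "'a \<Rightarrow> 'a \<Rightarrow> 'c"
  assumes closed [simp]: "\<lbrakk>x \<in> carrier K; y \<in> carrier K\<rbrakk> \<Longrightarrow> f x y \<in> carrier G"
    and self: "x \<in> carrier K \<Longrightarrow> f x x = \<one>\<^bsub>G\<^esub>"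
    and mult_right: "\<lbrakk>x \<in> carrier K; y \<in> carrier K; z \<in> carrier K\<rbrakk> \<Longrightarrow>
      f x (y \<otimes>\<^bsub>K\<^esub> z) = f x y \<otimes>\<^bsub>G\<^esub> f (conjugate K y x) (conjugate K y z)"
    and mult_left: "\<lbrakk>x \<in> carrier K; y \<in> carrier K; z \<in> carrier K\<rbrakk> \<Longrightarrow>
      f (x \<otimes>\<^bsub>K\<^esub> y) z = f (conjugate K x y) (conjugate K x z) \<otimes>\<^bsub>G\<^esub> f x z"

locale dihedral_exterior_pairing =
  dihedral K a b n + exterior_pairing K G f for K (structure) and a b n and G (structure) and f
begin

text \<open>
  Rotations act trivially on each other by conjugation, so on them the pairing is a homomorphism
  in each argument, and \<open>f b b = 1\<close>.
\<close>

lemma rotation_rotation: "f (b [^] j) (b [^] k) = \<one>\<^bsub>G\<^esub>" for j k :: int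
proof -
  have left: "f (b [^] (i + j)) (b [^] k) = f (b [^] i) (b [^] k) \<otimes>\<^bsub>G\<^esub> f (b [^] j) (b [^] k)"
    for i j k :: int
    using mult_left[of "b [^] j" "b [^] i" "b [^] k"]
    by (simp add: conjugate_rotation_rotation add.commute flip: int_pow_mult)
  have right: "f (b [^] i) (b [^] (j + k)) = f (b [^] i) (b [^] j) \<otimes>\<^bsub>G\<^esub> f (b [^] i) (b [^] k)"
    for i j k :: int
    using mult_right[of "b [^] i" "b [^] j" "b [^] k"]
    by (simp add: conjugate_rotation_rotation flip: int_pow_mult)
  have "f (b [^] j) (b [^] k) = f (b [^] j) (b [^] (1 :: int)) [^]\<^bsub>G\<^esub> k"
    by (rule int_add_hom_eq_int_pow) (simp_all add: right G.is_group)
  also have "f (b [^] j) (b [^] (1 :: int)) = f (b [^] (1 :: int)) (b [^] (1 :: int)) [^]\<^bsub>G\<^esub> j"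
    by (rule int_add_hom_eq_int_pow[where h = "\<lambda>j. f (b [^] j) (b [^] (1 :: int))"])
      (simp_all add: left G.is_group del: int_pow_1)
  finally show ?thesis
    by (simp add: self)
qed

text \<open>
  The value does not depend on the reflection, because \<open>a\<close> can be written as the product of
  \<open>b\<^sup>m\<close> and \<open>b\<^sup>-\<^sup>m a\<close>, and conjugation by \<open>b\<^sup>m\<close> turns the second factor into \<open>b\<^sup>m a\<close>.
  Hence the conjugation in the expansion of the right argument has no effect, and the pairing is
  a homomorphism in the rotation.
\<close>

lemma reflection_rotation: "f (b [^] m \<otimes> a) (b [^] j) = f a b [^]\<^bsub>G\<^esub> j" for m j :: int
proof -
  have indep: "f (b [^] m \<otimes> a) (b [^] j) = f a (b [^] j)" for m j :: int
    using mult_left[of "b [^] m" "b [^] (- m) \<otimes> a" "b [^] j"]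
    by (simp add: conjugate_rotation_reflection conjugate_rotation_rotation rotation_mult_reflection
        rotation_rotation)
  have "f a (b [^] (j + k)) = f a (b [^] j) \<otimes>\<^bsub>G\<^esub> f a (b [^] k)" for j k :: int
    using mult_right[of a "b [^] j" "b [^] k"] conjugate_rotation_reflection[of j 0]
    by (simp add: int_pow_mult conjugate_rotation_rotation indep)
  then have "f a (b [^] j) = f a (b [^] (1 :: int)) [^]\<^bsub>G\<^esub> j"
    by (intro int_add_hom_eq_int_pow) (simp_all add: G.is_group)
  with indep show ?thesis by simp
qed

text \<open>
  A reflection is a rotation times any other reflection. After expanding, the factor with two
  reflections pairs an element with itself. The next lemma uses the same idea in the left argument.
\<close>

lemma reflection_reflection:
  "f (b [^] j \<otimes> a) (b [^] m \<otimes> a) = f a b [^]\<^bsub>G\<^esub> (m - j)" for m j :: int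
  using mult_right[of "b [^] j \<otimes> a" "b [^] (m - j)" "b [^] j \<otimes> a"]
  by (simp add: rotation_mult_reflection conjugate_rotation_reflection self reflection_rotation)

lemma rotation_reflection: "f (b [^] j) (b [^] m \<otimes> a) = f a b [^]\<^bsub>G\<^esub> (- j)" for m j :: int
  using mult_left[of "b [^] j" "b [^] m \<otimes> a" "b [^] m \<otimes> a"]
  by (simp add: rotation_mult_reflection conjugate_rotation_reflection self reflection_reflection)

lemma value_is_power:
  assumes "x \<in> carrier K" and "y \<in> carrier K"
  shows "\<exists>k :: int. f x y = f a b [^]\<^bsub>G\<^esub> k"
  using assms
  by (elim carrier_cases; hypsubst; unfold rotation_rotation reflection_rotation rotation_reflection
      reflection_reflection) (metis int_pow_0, blast+)

lemma values_commute:
  assumes "x \<in> carrier K" "y \<in> carrier K" "u \<in> carrier K" "v \<in> carrier K"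
  shows "f x y \<otimes>\<^bsub>G\<^esub> f u v = f u v \<otimes>\<^bsub>G\<^esub> f x y"
proof -
  obtain k l :: int where "f x y = f a b [^]\<^bsub>G\<^esub> k" "f u v = f a b [^]\<^bsub>G\<^esub> l"
    using value_is_power assms by meson
  then show ?thesis
    by (simp add: add.commute flip: G.int_pow_mult)
qed

lemma value_pow_n: "f a b [^]\<^bsub>G\<^esub> n = \<one>\<^bsub>G\<^esub>"
  using reflection_rotation[of 0 "int n"] reflection_rotation[of 0 0]
  by (simp add: int_pow_int b_pow_n)

end


section \<open>Multiplicative Lie algebras given by a presentation\<close>

lemma lterms_simps [simp]:
  "LGen g \<in> lterms X \<longleftrightarrow> g \<in> X" "LOne \<in> lterms X"
  "LMult s t \<in> lterms X \<longleftrightarrow> s \<in> lterms X \<and> t \<in> lterms X"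
  "LInv s \<in> lterms X \<longleftrightarrow> s \<in> lterms X"
  "LStar s t \<in> lterms X \<longleftrightarrow> s \<in> lterms X \<and> t \<in> lterms X"
  by (auto simp: lterms_def)

lemma lie_cong_in_lterms: "(s, t) \<in> lie_cong X R \<Longrightarrow> s \<in> lterms X \<and> t \<in> lterms X"
  by (induction rule: lie_cong.induct) auto

lemma equiv_lie_cong: "equiv (lterms X) (lie_cong X R)"
  by (rule equivI)
    (auto simp: refl_on_def sym_def trans_def dest: lie_cong_in_lterms
      intro: lie_cong.refl lie_cong.sym lie_cong.trans)

lemma lie_cong_class_eqI: "(s, t) \<in> lie_cong X R \<Longrightarrow> lie_cong X R `` {s} = lie_cong X R `` {t}"
  by (rule equiv_class_eq[OF equiv_lie_cong])

locale lie_presentation =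
  fixes X :: "'g set" and R :: "('g lterm \<times> 'g lterm) set"
begin

abbreviation L where "L \<equiv> presented_lie_group X R"

abbreviation lstar (infixl \<open>\<star>\<close> 70) where "lstar \<equiv> presented_lie_star X R"

abbreviation cls where "cls t \<equiv> lie_cong X R `` {t}"

lemma class_in_carrier: "t \<in> lterms X \<Longrightarrow> cls t \<in> carrier L"
  by (simp add: presented_lie_group_def quotientI)

lemma carrierE:
  assumes "x \<in> carrier L"
  obtains t where "t \<in> lterms X" "x = cls t"
  using assms by (auto simp: presented_lie_group_def elim: quotientE)

lemma class_one: "\<one>\<^bsub>L\<^esub> = cls LOne"
  by (simp add: presented_lie_group_def)

lemma class_mult:
  assumes "s \<in> lterms X" and "t \<in> lterms X"
  shows "cls s \<otimes>\<^bsub>L\<^esub> cls t = cls (LMult s t)"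
proof -
  have "(LMult s t, u) \<in> lie_cong X R"
    if "(s, s') \<in> lie_cong X R" "(t, t') \<in> lie_cong X R" "(LMult s' t', u) \<in> lie_cong X R" for s' t' u
    using that lie_cong.mult lie_cong.trans by blast
  with assms show ?thesis
    by (auto simp: presented_lie_group_def intro: lie_cong.refl)
qed

lemma class_star:
  assumes "s \<in> lterms X" and "t \<in> lterms X"
  shows "cls s \<star> cls t = cls (LStar s t)"
proof -
  have "(LStar s t, u) \<in> lie_cong X R"
    if "(s, s') \<in> lie_cong X R" "(t, t') \<in> lie_cong X R" "(LStar s' t', u) \<in> lie_cong X R" for s' t' u
    using that lie_cong.star lie_cong.trans by blast
  with assms show ?thesis
    by (auto simp: presented_lie_star_def intro: lie_cong.refl)
qed

lemma group_presented_lie_group: "group L"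
proof (rule groupI)
  fix x y z
  assume "x \<in> carrier L" "y \<in> carrier L" "z \<in> carrier L"
  then show "x \<otimes>\<^bsub>L\<^esub> y \<otimes>\<^bsub>L\<^esub> z = x \<otimes>\<^bsub>L\<^esub> (y \<otimes>\<^bsub>L\<^esub> z)"
    by (elim carrierE) (simp add: class_mult lie_cong_class_eqI lie_cong.assoc)
next
  fix x assume "x \<in> carrier L"
  then show "\<one>\<^bsub>L\<^esub> \<otimes>\<^bsub>L\<^esub> x = x"
    by (elim carrierE) (simp add: class_mult class_one lie_cong_class_eqI lie_cong.l_one)
next
  fix x assume "x \<in> carrier L"
  then obtain t where t: "t \<in> lterms X" "x = cls t" by (elim carrierE)
  show "\<exists>y\<in>carrier L. y \<otimes>\<^bsub>L\<^esub> x = \<one>\<^bsub>L\<^esub>"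
    by (rule bexI[of _ "cls (LInv t)"])
      (simp_all add: t class_mult class_one lie_cong_class_eqI lie_cong.l_inv class_in_carrier)
qed (auto elim!: carrierE simp: class_mult class_one class_in_carrier)

lemma class_inv: "t \<in> lterms X \<Longrightarrow> inv\<^bsub>L\<^esub> (cls t) = cls (LInv t)"
  by (rule group.inv_equality[OF group_presented_lie_group])
    (simp_all add: class_mult class_one lie_cong_class_eqI lie_cong.l_inv class_in_carrier)

lemmas class_simps = class_mult class_inv class_star class_one conjugate_def

lemma mult_Lie_algebra_presented: "mult_Lie_algebra L lstar"
proof (intro mult_Lie_algebra.intro group_presented_lie_group mult_Lie_algebra_axioms.intro)
  fix x y assume "x \<in> carrier L" "y \<in> carrier L"
  then show "x \<star> y \<in> carrier L"
    by (elim carrierE) (simp add: class_star class_in_carrier)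
next
  fix x assume "x \<in> carrier L"
  then show "x \<star> x = \<one>\<^bsub>L\<^esub>"
    by (elim carrierE) (simp add: class_simps lie_cong_class_eqI lie_cong.star_self)
next
  fix x y z assume "x \<in> carrier L" "y \<in> carrier L" "z \<in> carrier L"
  then obtain s t u where "s \<in> lterms X" "t \<in> lterms X" "u \<in> lterms X"
    and "x = cls s" "y = cls t" "z = cls u"
    by (elim carrierE) blast
  then show "x \<star> (y \<otimes>\<^bsub>L\<^esub> z) = (x \<star> y) \<otimes>\<^bsub>L\<^esub> conjugate L y (x \<star> z)"
    and "(x \<otimes>\<^bsub>L\<^esub> y) \<star> z = conjugate L x (y \<star> z) \<otimes>\<^bsub>L\<^esub> (x \<star> z)"
    and "((x \<star> y) \<star> conjugate L y z) \<otimes>\<^bsub>L\<^esub> ((y \<star> z) \<star> conjugate L z x)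
        \<otimes>\<^bsub>L\<^esub> ((z \<star> x) \<star> conjugate L x y) = \<one>\<^bsub>L\<^esub>"
    and "conjugate L z (x \<star> y) = conjugate L z x \<star> conjugate L z y"
    by (simp_all add: class_simps lie_cong_class_eqI lie_cong.star_mult_right
        lie_cong.star_mult_left lie_cong.star_Jacobi lie_cong.conjugate_star)
qed

lemma subalgebra_containing_generators_is_everything:
  assumes H: "subgroup H L"
    and gens: "\<And>g. g \<in> X \<Longrightarrow> cls (LGen g) \<in> H"
    and star: "\<And>x y. \<lbrakk>x \<in> H; y \<in> H\<rbrakk> \<Longrightarrow> x \<star> y \<in> H"
  shows "H = carrier L"
proof
  have "cls t \<in> H" if "t \<in> lterms X" for t
    using that
  proof (induction t)
    case LOne
    then show ?case using subgroup.one_closed[OF H] by (simp add: class_one)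
  next
    case (LMult s t)
    then show ?case using subgroup.m_closed[OF H] by (simp flip: class_mult)
  next
    case (LInv t)
    then show ?case using subgroup.m_inv_closed[OF H] by (simp flip: class_inv)
  next
    case (LStar s t)
    then show ?case using star by (simp flip: class_star)
  qed (simp add: gens)
  then show "carrier L \<subseteq> H"
    by (auto elim: carrierE)
qed (rule subgroup.subset[OF H])

end

text \<open>
  The evaluation of terms in a group with the trivial Lie product, which satisfies the axioms of
  multiplicative Lie algebras in every group.
\<close>

primrec lie_eval :: "('b, 'm) monoid_scheme \<Rightarrow> ('g \<Rightarrow> 'b) \<Rightarrow> 'g lterm \<Rightarrow> 'b" where
  "lie_eval G h (LGen g) = h g"
| "lie_eval G h LOne = \<one>\<^bsub>G\<^esub>"
| "lie_eval G h (LMult s t) = lie_eval G h s \<otimes>\<^bsub>G\<^esub> lie_eval G h t"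
| "lie_eval G h (LInv t) = inv\<^bsub>G\<^esub> (lie_eval G h t)"
| "lie_eval G h (LStar s t) = \<one>\<^bsub>G\<^esub>"

context group
begin

lemma lie_eval_closed:
  assumes "\<And>g. g \<in> X \<Longrightarrow> h g \<in> carrier G" and "t \<in> lterms X"
  shows "lie_eval G h t \<in> carrier G"
  using assms(2) by (induction t) (simp_all add: assms(1))

lemma lie_eval_cong:
  assumes h: "\<And>g. g \<in> X \<Longrightarrow> h g \<in> carrier G"
    and R: "\<And>s t. \<lbrakk>(s, t) \<in> R; s \<in> lterms X; t \<in> lterms X\<rbrakk> \<Longrightarrow> lie_eval G h s = lie_eval G h t"
    and "(s, t) \<in> lie_cong X R"
  shows "lie_eval G h s = lie_eval G h t"
  using assms(3)
  by induction (simp_all add: R m_assoc lie_eval_closed[OF h])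

text \<open>
  Von Dyck's theorem for targets with the trivial Lie product.
\<close>

theorem presented_lie_group_hom:
  assumes h: "\<And>g. g \<in> X \<Longrightarrow> h g \<in> carrier G"
    and R: "\<And>s t. \<lbrakk>(s, t) \<in> R; s \<in> lterms X; t \<in> lterms X\<rbrakk> \<Longrightarrow> lie_eval G h s = lie_eval G h t"
  shows "\<exists>\<phi> \<in> hom (presented_lie_group X R) G. \<forall>g\<in>X. \<phi> (lie_cong X R `` {LGen g}) = h g"
proof -
  interpret P: lie_presentation X R .
  define \<phi> where "\<phi> C = lie_eval G h (SOME t. t \<in> C)" for C
  have eval: "\<phi> (P.cls t) = lie_eval G h t" if t: "t \<in> lterms X" for t
  proof -
    have "t \<in> P.cls t"
      using t by (simp add: lie_cong.refl)
    then have "(SOME s. s \<in> P.cls t) \<in> P.cls t"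
      by (rule someI)
    then have "(t, SOME s. s \<in> P.cls t) \<in> lie_cong X R"
      by simp
    from lie_eval_cong[OF h R this, symmetric] show ?thesis
      unfolding \<phi>_def .
  qed
  show ?thesis
  proof (intro bexI[of _ \<phi>] ballI homI)
    fix x y assume "x \<in> carrier P.L" "y \<in> carrier P.L"
    then show "\<phi> (x \<otimes>\<^bsub>P.L\<^esub> y) = \<phi> x \<otimes> \<phi> y"
      by (elim P.carrierE) (simp add: P.class_mult eval)
  qed (auto elim!: P.carrierE simp: eval lie_eval_closed[OF h])
qed

end


section \<open>Lie products that vanish on generators\<close>

context mult_Lie_algebra
begin

lemma star_one_left: "x \<in> carrier K \<Longrightarrow> \<one> \<star> x = \<one>"
  using star_mult_left[of \<one> \<one> x] star_closed[of \<one> x] by (simp add: conjugate_def)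

text \<open>
  If \<open>x \<star> y = 1\<close>, then expanding both arguments of \<open>(x y) \<star> (x y) = 1\<close> leaves only a
  conjugate of \<open>y \<star> x\<close>.
\<close>

lemma star_eq_one_commute:
  assumes "x \<in> carrier K" "y \<in> carrier K" "x \<star> y = \<one>"
  shows "y \<star> x = \<one>"
proof -
  have "(x \<otimes> y) \<star> (x \<otimes> y) = conjugate K x (y \<star> x)"
    using assms by (subst star_mult_right) (simp_all add: star_mult_left star_self conjugate_def star_closed)
  then have conj: "conjugate K x (y \<star> x) = \<one>"
    using star_self[of "x \<otimes> y"] assms by simp
  have "inv x \<otimes> conjugate K x (y \<star> x) \<otimes> x = \<one>"
    unfolding conj using assms by simp
  then show ?thesis
    using assms by (simp add: conjugate_def word_simps star_closed)
qed

lemma subgroup_star_annihilator: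
  assumes "S \<subseteq> carrier K"
  shows "subgroup {x \<in> carrier K. \<forall>s\<in>S. x \<star> s = \<one>} K"
proof (rule subgroupI)
  fix x assume "x \<in> {x \<in> carrier K. \<forall>s\<in>S. x \<star> s = \<one>}"
  moreover have "inv x \<star> s = \<one>" if "x \<in> carrier K" "s \<in> carrier K" "x \<star> s = \<one>" for s
    using that star_mult_left[of "inv x" x s] star_one_left[of s] star_closed[of "inv x" s]
    by (simp add: conjugate_def)
  ultimately show "inv x \<in> {x \<in> carrier K. \<forall>s\<in>S. x \<star> s = \<one>}"
    using assms by auto
next
  show "{x \<in> carrier K. \<forall>s\<in>S. x \<star> s = \<one>} \<noteq> {}"
    using assms star_one_left by auto
qed (use assms in \<open>auto simp: star_mult_left conjugate_def subset_iff\<close>)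

text \<open>
  The left annihilator of any set is a subgroup, and \<open>star_eq_one_commute\<close> exchanges the two sides.
  So vanishing extends from generators to the generated subgroup in one argument at a time.
\<close>

lemma star_trivial_on_generate:
  assumes S: "S \<subseteq> carrier K" and trivial: "\<And>x y. \<lbrakk>x \<in> S; y \<in> S\<rbrakk> \<Longrightarrow> x \<star> y = \<one>"
    and xy: "x \<in> generate K S" "y \<in> generate K S"
  shows "x \<star> y = \<one>"
proof -
  \<comment> \<open>\<open>T\<close> is \<open>S\<close> in the first use and the generated subgroup in the second.\<close>
  have left: "x \<star> s = \<one>" if "x \<in> generate K S" "T \<subseteq> carrier K" "s \<in> T" "\<And>x s. \<lbrakk>x \<in> S; s \<in> T\<rbrakk> \<Longrightarrow> x \<star> s = \<one>"
    for x s T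
    using generate_subgroup_incl[OF _ subgroup_star_annihilator[of T], of S] that S by blast
  have S_gen: "s \<star> x = \<one>" if "x \<in> generate K S" "s \<in> S" for x s
    using left[OF that(1) S that(2)] trivial that S generate_in_carrier[OF S]
    by (blast intro: star_eq_one_commute)
  show ?thesis
    using left[OF xy(1) generate_incl[OF S] xy(2)] S_gen by blast
qed

text \<open>
  The axioms on products become those of an exterior pairing once conjugation, which respects
  \<open>\<star>\<close>, is moved inside.
\<close>

lemma exterior_pairing_star: "exterior_pairing K K star"
  by unfold_locales
    (simp_all add: star_closed star_self star_mult_right star_mult_left conjugate_star)

end


section \<open>Pairings and homomorphisms on the Lie exterior square\<close>

lemma (in group) eq_of_inv_mult_eq_one:
  assumes "inv x \<otimes> y \<otimes> z = \<one>" "x \<in> carrier G" "y \<in> carrier G" "z \<in> carrier G"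
  shows "x = y \<otimes> z"
  using assms by (metis inv_solve_left' m_assoc m_closed inv_closed r_one one_closed)

lemma (in group) exterior_pairing_commutator: "exterior_pairing G G (commutator G)"
  by unfold_locales (simp_all add: commutator_def conjugate_def word_simps)

lemma conjugate_closed [simp]:
  "\<lbrakk>group G; x \<in> carrier G; y \<in> carrier G\<rbrakk> \<Longrightarrow> conjugate G x y \<in> carrier G"
  by (simp add: conjugate_def group.is_monoid monoid.m_closed group.inv_closed)

lemma ext_gens_simps [simp]:
  "Gen_wedge x y \<in> ext_gens K \<longleftrightarrow> x \<in> carrier K \<and> y \<in> carrier K"
  "Gen_bracket x y \<in> ext_gens K \<longleftrightarrow> x \<in> carrier K \<and> y \<in> carrier K"
  by (auto simp: ext_gens_def)

locale ext_square = mult_Lie_algebra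
begin

sublocale P: lie_presentation "ext_gens K" "ext_rels K star" .

abbreviation wedge_class where "wedge_class x y \<equiv> P.cls (LGen (Gen_wedge x y))"
abbreviation bracket_class where "bracket_class x y \<equiv> P.cls (LGen (Gen_bracket x y))"

lemma class_eq_of_rel:
  "\<lbrakk>(s, t) \<in> ext_rels K star; s \<in> lterms (ext_gens K); t \<in> lterms (ext_gens K)\<rbrakk> \<Longrightarrow> P.cls s = P.cls t"
  by (rule lie_cong_class_eqI, rule lie_cong.rel)

lemma exterior_pairing_wedge: "exterior_pairing K P.L wedge_class"
proof (intro exterior_pairing.intro exterior_pairing_axioms.intro is_group P.group_presented_lie_group)
  interpret L: group P.L by (rule P.group_presented_lie_group)
  fix x y z assume xyz: "x \<in> carrier K" "y \<in> carrier K" "z \<in> carrier K"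
  from class_eq_of_rel[OF ext_rels.wedge_mult_right[OF xyz]] xyz
  show "wedge_class x (y \<otimes> z) =
      wedge_class x y \<otimes>\<^bsub>P.L\<^esub> wedge_class (conjugate K y x) (conjugate K y z)"
    by (intro L.eq_of_inv_mult_eq_one)
      (simp_all add: P.class_mult P.class_inv P.class_one P.class_in_carrier is_group)
  from class_eq_of_rel[OF ext_rels.wedge_mult_left[OF xyz]] xyz
  show "wedge_class (x \<otimes> y) z =
      wedge_class (conjugate K x y) (conjugate K x z) \<otimes>\<^bsub>P.L\<^esub> wedge_class x z"
    by (intro L.eq_of_inv_mult_eq_one)
      (simp_all add: P.class_mult P.class_inv P.class_one P.class_in_carrier is_group)
qed (simp_all add: P.class_in_carrier P.class_one class_eq_of_rel ext_rels.wedge_self)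

lemma exterior_pairing_bracket: "exterior_pairing K P.L bracket_class"
proof (intro exterior_pairing.intro exterior_pairing_axioms.intro is_group P.group_presented_lie_group)
  interpret L: group P.L by (rule P.group_presented_lie_group)
  fix x y z assume xyz: "x \<in> carrier K" "y \<in> carrier K" "z \<in> carrier K"
  from class_eq_of_rel[OF ext_rels.bracket_mult_right[OF xyz]] xyz
  show "bracket_class x (y \<otimes> z) =
      bracket_class x y \<otimes>\<^bsub>P.L\<^esub> bracket_class (conjugate K y x) (conjugate K y z)"
    by (intro L.eq_of_inv_mult_eq_one)
      (simp_all add: P.class_mult P.class_inv P.class_one P.class_in_carrier is_group)
  from class_eq_of_rel[OF ext_rels.bracket_mult_left[OF xyz]] xyz
  show "bracket_class (x \<otimes> y) z =
      bracket_class (conjugate K x y) (conjugate K x z) \<otimes>\<^bsub>P.L\<^esub> bracket_class x z"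
    by (intro L.eq_of_inv_mult_eq_one)
      (simp_all add: P.class_mult P.class_inv P.class_one P.class_in_carrier is_group)
qed (simp_all add: P.class_in_carrier P.class_one class_eq_of_rel ext_rels.bracket_self)

text \<open>
  The defining relations identify these two elements with the commutator of \<open>x \<and> y\<close> with itself.
\<close>

lemma
  assumes "x \<in> carrier K" "y \<in> carrier K"
  shows commutator_bracket_wedge:
      "commutator P.L (bracket_class x y) (wedge_class x y) = \<one>\<^bsub>P.L\<^esub>"
    and star_bracket_wedge:
      "P.lstar (bracket_class x y) (wedge_class x y) = \<one>\<^bsub>P.L\<^esub>"
proof -
  interpret L: group P.L by (rule P.group_presented_lie_group)
  let ?w = "Gen_wedge x y" and ?c = "Gen_bracket x y"
  have "P.cls (lcomm (LGen ?w) (LGen ?w)) = \<one>\<^bsub>P.L\<^esub>"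
    using assms by (simp add: L.word_simps P.class_in_carrier flip: P.class_mult P.class_inv)
  moreover have "P.cls (lcomm (LGen ?w) (LGen ?w)) = P.cls (lcomm (LGen ?c) (LGen ?w))"
    using assms by (intro class_eq_of_rel ext_rels.comm_wedge_wedge) simp_all
  moreover have "P.cls (lcomm (LGen ?c) (LGen ?w)) = P.cls (LStar (LGen ?c) (LGen ?w))"
    using assms by (intro class_eq_of_rel ext_rels.comm_bracket_wedge) simp_all
  ultimately show "commutator P.L (bracket_class x y) (wedge_class x y) = \<one>\<^bsub>P.L\<^esub>"
    and "P.lstar (bracket_class x y) (wedge_class x y) = \<one>\<^bsub>P.L\<^esub>"
    using assms by (simp_all add: commutator_def P.class_mult P.class_inv P.class_star)
qed

text \<open>
  The two kinds of generators go to different factors, so the relation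
  \<open>[x \<and> y, u \<and> v] = [[x, y]\<^sub>0, u \<and> v]\<close> holds when commutators commute. Lie products are
  evaluated as \<open>1\<close>, so the relation for \<open>(x \<and> y) \<star> (u \<and> v)\<close> holds when values of
  \<open>\<star>\<close> commute. The other relations come down to identities that hold in all groups.
\<close>

theorem ext_square_hom_commutators:
  assumes comm: "\<And>x y u v. \<lbrakk>x \<in> carrier K; y \<in> carrier K; u \<in> carrier K; v \<in> carrier K\<rbrakk> \<Longrightarrow>
      commutator K (commutator K x y) (commutator K u v) = \<one>"
    and star: "\<And>x y u v. \<lbrakk>x \<in> carrier K; y \<in> carrier K; u \<in> carrier K; v \<in> carrier K\<rbrakk> \<Longrightarrow>
      commutator K (x \<star> y) (u \<star> v) = \<one>"
  shows "\<exists>\<phi> \<in> hom P.L (K \<times>\<times> K). \<forall>x \<in> carrier K. \<forall>y \<in> carrier K.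
    \<phi> (wedge_class x y) = (commutator K x y, \<one>) \<and> \<phi> (bracket_class x y) = (\<one>, commutator K x y)"
proof -
  interpret KK: group "K \<times>\<times> K"
    by (intro DirProd_group is_group)
  have commutator_closed: "commutator K x y \<in> carrier K" if "x \<in> carrier K" "y \<in> carrier K" for x y
    using that by (simp add: commutator_def)
  define h where "h g = (case g of Gen_wedge x y \<Rightarrow> (commutator K x y, \<one>)
    | Gen_bracket x y \<Rightarrow> (\<one>, commutator K x y))" for g
  have h: "h g \<in> carrier (K \<times>\<times> K)" if "g \<in> ext_gens K" for g
    using that by (auto simp: h_def ext_gens_def commutator_closed)
  have R: "lie_eval (K \<times>\<times> K) h s = lie_eval (K \<times>\<times> K) h t" if "(s, t) \<in> ext_rels K star" for s t
    using that
  proof cases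
    case (comm_wedge_wedge x y u v)
    then show ?thesis
      using comm[of x y u v]
      by (simp add: h_def commutator_closed is_group commutator_def[of K "commutator K x y"])
  next
    case (comm_bracket_wedge x y u v)
    then show ?thesis
      by (simp add: h_def commutator_closed is_group)
  next
    case (comm_bracket_bracket x y u v)
    then show ?thesis
      by (simp add: h_def commutator_closed is_group commutator_def[of K "commutator K x y"])
  next
    case (star_wedge_wedge x y u v)
    then show ?thesis
      by (simp add: h_def star)
  qed (simp_all add: h_def commutator_def conjugate_def word_simps is_group)
  obtain \<phi> where \<phi>: "\<phi> \<in> hom P.L (K \<times>\<times> K)" "\<And>g. g \<in> ext_gens K \<Longrightarrow> \<phi> (P.cls (LGen g)) = h g"
    using KK.presented_lie_group_hom[of "ext_gens K" h "ext_rels K star"] h R by blast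
  show ?thesis
    using \<phi> by (intro bexI[of _ \<phi>]) (simp_all add: h_def)
qed

end


section \<open>The Lie exterior square of a dihedral group\<close>

locale dihedral_ext_square =
  dihedral K a b n + ext_square K star for K (structure) and a b n and star (infixl \<open>\<star>\<close> 70)
begin

sublocale L: mult_Lie_algebra P.L P.lstar
  by (rule P.mult_Lie_algebra_presented)

sublocale W: dihedral_exterior_pairing K a b n P.L wedge_class
  by (intro dihedral_exterior_pairing.intro dihedral_axioms exterior_pairing_wedge)

sublocale C: dihedral_exterior_pairing K a b n P.L bracket_class
  by (intro dihedral_exterior_pairing.intro dihedral_axioms exterior_pairing_bracket)

sublocale COM: dihedral_exterior_pairing K a b n K "commutator K"
  by (intro dihedral_exterior_pairing.intro dihedral_axioms exterior_pairing_commutator)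

sublocale STAR: dihedral_exterior_pairing K a b n K star
  by (intro dihedral_exterior_pairing.intro dihedral_axioms exterior_pairing_star)

abbreviation w where "w \<equiv> wedge_class a b"
abbreviation c where "c \<equiv> bracket_class a b"

lemma w_closed: "w \<in> carrier P.L" and c_closed: "c \<in> carrier P.L"
  by (simp_all add: P.class_in_carrier)

lemma star_trivial_on_generators:
  assumes "x \<in> {w, c}" "y \<in> {w, c}"
  shows "P.lstar x y = \<one>\<^bsub>P.L\<^esub>"
proof -
  have "P.lstar c w = \<one>\<^bsub>P.L\<^esub>"
    by (rule star_bracket_wedge) simp_all
  moreover from this have "P.lstar w c = \<one>\<^bsub>P.L\<^esub>"
    by (rule L.star_eq_one_commute[OF c_closed w_closed])
  ultimately show ?thesis
    using assms L.star_self[OF w_closed] L.star_self[OF c_closed] by (elim insertE emptyE) simp_all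
qed

text \<open>
  The generated subgroup contains all generators of the algebra because values of exterior pairings
  are powers, and it is closed under the Lie product because that product is trivial on it.
\<close>

lemma generate_w_c: "generate P.L {w, c} = carrier P.L"
proof (rule P.subalgebra_containing_generators_is_everything)
  show subgroup: "subgroup (generate P.L {w, c}) P.L"
    by (rule L.generate_is_subgroup) (simp add: w_closed c_closed)
  have "w [^]\<^bsub>P.L\<^esub> k \<in> generate P.L {w, c}" "c [^]\<^bsub>P.L\<^esub> k \<in> generate P.L {w, c}" for k :: int
    using L.subgroup_int_pow_closed[OF subgroup] by (simp_all add: generate.incl)
  then show "P.cls (LGen g) \<in> generate P.L {w, c}" if "g \<in> ext_gens K" for g
    using that W.value_is_power C.value_is_power by (cases g) (auto, metis+)
  show "P.lstar x y \<in> generate P.L {w, c}"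
    if "x \<in> generate P.L {w, c}" "y \<in> generate P.L {w, c}" for x y
    using L.star_trivial_on_generate[OF _ star_trivial_on_generators that] w_closed c_closed
    by (simp add: generate.one)
qed

lemma ext_square_star_trivial: "trivial_mult_Lie_algebra P.L P.lstar"
  unfolding trivial_mult_Lie_algebra_def
proof (intro conjI L.mult_Lie_algebra_axioms ballI)
  fix x y assume "x \<in> carrier P.L" "y \<in> carrier P.L"
  then have "x \<in> generate P.L {w, c}" "y \<in> generate P.L {w, c}"
    by (simp_all only: generate_w_c)
  then show "P.lstar x y = \<one>\<^bsub>P.L\<^esub>"
    by (rule L.star_trivial_on_generate[OF _ star_trivial_on_generators, rotated 3])
      (simp_all add: w_closed c_closed)
qed

text \<open>
  Surjectivity of \<open>(j, k) \<mapsto> w\<^sup>j c\<^sup>k\<close> is \<open>generate_w_c\<close>. Injectivity is seen after applying the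
  homomorphism of \<open>ext_square_hom_commutators\<close>, since the commutator of \<open>a\<close> and \<open>b\<close> is the
  inverse square of \<open>b\<close> and \<open>2\<close> is invertible modulo \<open>n\<close>.
\<close>

lemma isomorphic_to_product:
  assumes "odd n" and b_pow: "\<And>j :: int. b [^] j = \<one> \<longleftrightarrow> int n dvd j"
  shows "P.L \<cong> integer_mod_group n \<times>\<times> integer_mod_group n"
proof -
  let ?Z = "integer_mod_group n"
  interpret ZZ: group "?Z \<times>\<times> ?Z"
    by (intro DirProd_group group_integer_mod_group)
  have carrier: "carrier ?Z = {0..<int n}"
    using odd_pos[OF \<open>odd n\<close>] by (simp add: carrier_integer_mod_group)
  have c_w: "c \<otimes>\<^bsub>P.L\<^esub> w = w \<otimes>\<^bsub>P.L\<^esub> c"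
    using commutator_bracket_wedge[of a b]
    by (simp add: L.commutator_eq_one_iff_commute w_closed c_closed)
  define \<Psi> where "\<Psi> = (\<lambda>(j :: int, k :: int). w [^]\<^bsub>P.L\<^esub> j \<otimes>\<^bsub>P.L\<^esub> c [^]\<^bsub>P.L\<^esub> k)"
  have hom: "\<Psi> \<in> hom (?Z \<times>\<times> ?Z) P.L"
  proof (rule homI)
    fix p q :: "int \<times> int"
    obtain j k j' k' where pq: "p = (j, k)" "q = (j', k')"
      by fastforce
    have "\<Psi> (p \<otimes>\<^bsub>?Z \<times>\<times> ?Z\<^esub> q) =
        w [^]\<^bsub>P.L\<^esub> j \<otimes>\<^bsub>P.L\<^esub> (w [^]\<^bsub>P.L\<^esub> j' \<otimes>\<^bsub>P.L\<^esub> c [^]\<^bsub>P.L\<^esub> k) \<otimes>\<^bsub>P.L\<^esub> c [^]\<^bsub>P.L\<^esub> k'"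
      by (simp add: \<Psi>_def pq L.int_pow_mod W.value_pow_n C.value_pow_n w_closed c_closed
          L.int_pow_mult L.m_assoc)
    also have "w [^]\<^bsub>P.L\<^esub> j' \<otimes>\<^bsub>P.L\<^esub> c [^]\<^bsub>P.L\<^esub> k = c [^]\<^bsub>P.L\<^esub> k \<otimes>\<^bsub>P.L\<^esub> w [^]\<^bsub>P.L\<^esub> j'"
      by (rule L.int_pow_commute[OF c_w[symmetric] w_closed c_closed])
    finally show "\<Psi> (p \<otimes>\<^bsub>?Z \<times>\<times> ?Z\<^esub> q) = \<Psi> p \<otimes>\<^bsub>P.L\<^esub> \<Psi> q"
      by (simp add: \<Psi>_def pq L.m_assoc w_closed c_closed)
  qed (auto simp: \<Psi>_def w_closed c_closed)
  have surj: "carrier P.L \<subseteq> \<Psi> ` carrier (?Z \<times>\<times> ?Z)"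
  proof -
    have "group_hom (?Z \<times>\<times> ?Z) P.L \<Psi>"
      by (intro group_hom.intro group_hom_axioms.intro hom ZZ.is_group L.is_group)
    then have "subgroup (\<Psi> ` carrier (?Z \<times>\<times> ?Z)) P.L"
      by (rule group_hom.img_is_subgroup)
    \<comment> \<open>The reduction covers \<open>n = 1\<close>, where \<open>1\<close> is not in the carrier of \<open>?Z\<close>.\<close>
    moreover have "w = \<Psi> (1 mod int n, 0)" "c = \<Psi> (0, 1 mod int n)"
      by (simp_all add: \<Psi>_def L.int_pow_mod W.value_pow_n C.value_pow_n w_closed c_closed)
    then have "{w, c} \<subseteq> \<Psi> ` carrier (?Z \<times>\<times> ?Z)"
      using \<open>odd n\<close> odd_pos by (fastforce simp: carrier)
    ultimately show ?thesis
      using L.generate_subgroup_incl by (simp flip: generate_w_c)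
  qed
  have inj: "inj_on \<Psi> (carrier (?Z \<times>\<times> ?Z))"
  proof -
    obtain \<phi> where \<phi>: "\<phi> \<in> hom P.L (K \<times>\<times> K)" "\<phi> w = (commutator K a b, \<one>)" "\<phi> c = (\<one>, commutator K a b)"
    proof -
      have "commutator K (commutator K x y) (commutator K u v) = \<one>" "commutator K (x \<star> y) (u \<star> v) = \<one>"
        if "x \<in> carrier K" "y \<in> carrier K" "u \<in> carrier K" "v \<in> carrier K" for x y u v
        using that COM.values_commute STAR.values_commute
        by (simp_all add: commutator_eq_one_iff_commute star_closed)
      from ext_square_hom_commutators[OF this] show ?thesis
        using that a_closed b_closed by blast
    qed
    have fst_snd: "fst \<circ> \<phi> \<in> hom P.L K" "snd \<circ> \<phi> \<in> hom P.L K"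
      using \<phi>(1) by (simp_all add: hom_pairwise)
    have \<phi>_\<Psi>: "\<phi> (\<Psi> (j, k)) = (b [^] (- 2 * j), b [^] (- 2 * k))" for j k
    proof -
      have "(fst \<circ> \<phi>) (\<Psi> (j, k)) = b [^] (- 2 * j)" "(snd \<circ> \<phi>) (\<Psi> (j, k)) = b [^] (- 2 * k)"
        unfolding \<Psi>_def prod.case
        by (simp_all add: hom_mult[OF fst_snd(1)] hom_mult[OF fst_snd(2)] w_closed c_closed
            hom_int_pow[OF fst_snd(1)] hom_int_pow[OF fst_snd(2)] L.is_group is_group \<phi>
            commutator_a_b int_pow_pow del: o_apply) (simp_all add: \<phi> commutator_a_b int_pow_pow)
      then show ?thesis
        by (simp add: prod_eq_iff)
    qed
    have cancel: "j = k" if "b [^] (- 2 * j) = b [^] (- 2 * k)" "j \<in> {0..<int n}" "k \<in> {0..<int n}" for j k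
    proof -
      have "b [^] (- 2 * j - - 2 * k) = \<one>"
        using that(1) by (subst int_pow_diff) simp_all
      then have "int n dvd 2 * (k - j)"
        using b_pow by (simp add: algebra_simps)
      then have "int n dvd k - j"
        using \<open>odd n\<close> coprime_dvd_mult_right_iff[of "int n" 2]
        by (metis coprime_right_2_iff_odd even_of_nat)
      then show ?thesis
        using that(2,3) by (metis atLeastLessThan_iff mod_eq_dvd_iff mod_pos_pos_trivial)
    qed
    show ?thesis
    proof (rule inj_onI)
      fix p q assume "p \<in> carrier (?Z \<times>\<times> ?Z)" "q \<in> carrier (?Z \<times>\<times> ?Z)" and eq: "\<Psi> p = \<Psi> q"
      then obtain j k j' k' where pq: "p = (j, k)" "q = (j', k')"
        and range: "j \<in> {0..<int n}" "k \<in> {0..<int n}" "j' \<in> {0..<int n}" "k' \<in> {0..<int n}"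
        by (auto simp: carrier)
      have "\<phi> (\<Psi> (j, k)) = \<phi> (\<Psi> (j', k'))"
        using eq by (simp add: pq)
      then have "b [^] (- 2 * j) = b [^] (- 2 * j')" "b [^] (- 2 * k) = b [^] (- 2 * k')"
        unfolding \<phi>_\<Psi> prod.inject by blast+
      with range show "p = q"
        using cancel pq by blast
    qed
  qed
  have "\<Psi> \<in> iso (?Z \<times>\<times> ?Z) P.L"
    using hom inj surj hom_carrier[OF hom] by (auto simp: iso_def bij_betw_def)
  then show ?thesis
    using ZZ.iso_sym by (auto simp: is_iso_def)
qed

end

theorem proposition3p10:
  fixes n i :: nat
    and star :: "dihedral_gen gterm set \<Rightarrow> dihedral_gen gterm set \<Rightarrow> dihedral_gen gterm set"
  assumes "odd n" and "1 \<le> i" and "i \<le> n"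
    and "mult_Lie_algebra (dihedral_group n) star"
    and "star (dihedral_a n) (dihedral_b n) = dihedral_b n [^]\<^bsub>dihedral_group n\<^esub> i"
  shows "ext_square_group (dihedral_group n) star \<cong> integer_mod_group n \<times>\<times> integer_mod_group n
       \<and> trivial_mult_Lie_algebra (ext_square_group (dihedral_group n) star)
                                  (ext_square_star (dihedral_group n) star)"
proof -
  interpret D: dihedral_ext_square "dihedral_group n" "dihedral_a n" "dihedral_b n" n star
    by (intro dihedral_ext_square.intro ext_square.intro dihedral_dihedral_group assms)
  show ?thesis
    unfolding ext_square_group_def ext_square_star_def
    using D.isomorphic_to_product[OF \<open>odd n\<close> dihedral_b_int_pow_eq_one_iff] D.ext_square_star_trivial by blast
qed

end
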